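(* If $G$ is a $C_5$-free graph on $n$ vertices with $n\geq 5$ and $\delta_2(G)\geq 3$, then $G$ is bipartite.
   Context: Graphs are finite and simple. $C_5$ is the cycle of length 5; a graph is $C_5$-free if it does not contain $C_5$ as a (not necessarily induced) subgraph. For a vertex $x$ of $G$, $N(x)=\{y\in V(G)\colon xy\in E(G)\}$. The minimum common degree $\delta_2(G)$ is the minimum of $|N(x)\cap N(y)|$ over all non-edges $xy$ of $G$, i.e. over all pairs of distinct non-adjacent vertices $x,y$; thus $\delta_2(G)\geq 3$ means that every two distinct non-adjacent vertices have at least 3 common neighbors. *)

theory Defs
  imports "Graph_Theory.Digraph_Component" "HOL-Library.Extended_Nat"
begin

text \<open>
  A finite simple graph is an instance of the locale predicate \<^const>\<open>graph\<close>: a finite, loop-free,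
  symmetric digraph without parallel arcs. An undirected edge is a pair of opposite arcs, and
  adjacency is \<open>x \<rightarrow>\<^bsub>G\<^esub> y\<close>.
\<close>

definition cycle_graph :: "nat \<Rightarrow> ('a, 'b) pre_digraph \<Rightarrow> bool" where
  "cycle_graph k H \<longleftrightarrow> graph H \<and> 3 \<le> k \<and>
     (\<exists>f. bij_betw f {..<k} (verts H) \<and>
       arcs_ends H = (\<Union>i<k. {(f i, f (Suc i mod k)), (f (Suc i mod k), f i)}))"

definition cycle_free :: "nat \<Rightarrow> ('a, 'b) pre_digraph \<Rightarrow> bool" where
  "cycle_free k G \<longleftrightarrow> \<not> (\<exists>H. subgraph H G \<and> cycle_graph k H)"

definition nbhd :: "('a, 'b) pre_digraph \<Rightarrow> 'a \<Rightarrow> 'a set" where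
  "nbhd G x = {y \<in> verts G. x \<rightarrow>\<^bsub>G\<^esub> y}"

definition non_edges :: "('a, 'b) pre_digraph \<Rightarrow> ('a \<times> 'a) set" where
  "non_edges G = {(x, y). x \<in> verts G \<and> y \<in> verts G \<and> x \<noteq> y \<and> \<not> x \<rightarrow>\<^bsub>G\<^esub> y}"

text \<open>
  The value lies in \<^typ>\<open>enat\<close> so that the minimum over the empty set of non-edges of a complete
  graph is \<open>\<infinity>\<close>; a lower bound on it is thus a statement about every non-edge.
\<close>

definition min_common_degree :: "('a, 'b) pre_digraph \<Rightarrow> enat" where
  "min_common_degree G = (INF (x, y) \<in> non_edges G. enat (card (nbhd G x \<inter> nbhd G y)))"

definition bipartite :: "('a, 'b) pre_digraph \<Rightarrow> bool" where
  "bipartite G \<longleftrightarrow> (\<exists>A B. verts G = A \<union> B \<and> A \<inter> B = {} \<and>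
     arcs_ends G \<subseteq> A \<times> B \<union> B \<times> A)"

end

theory Submission
  imports Defs
begin

text \<open>
  A complete graph on four vertices \<open>a, b, c, d\<close> is impossible: a further vertex \<open>w\<close> adjacent to \<open>a\<close> is
  adjacent to none of \<open>b, c, d\<close>, so a common neighbour \<open>u\<close> of \<open>w\<close> and \<open>b\<close> closes the 5-cycle \<open>a w u b c\<close>;
  yet a fifth vertex shares neighbours with \<open>a\<close>. If \<open>abc\<close> is a triangle and \<open>d\<close> is adjacent to \<open>a\<close> and
  \<open>b\<close> but not to \<open>c\<close>, a third common neighbour \<open>w\<close> of \<open>c\<close> and \<open>d\<close> closes the 5-cycle \<open>d w c a b\<close>. So a
  vertex off a triangle has at most one neighbour on it, and the argument for complete graphs now
  excludes triangles. In a triangle-free \<open>G\<close>, the neighbourhood of any vertex \<open>x\<close> and its complement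
  form a bipartition: an edge \<open>uv\<close> inside the complement would close a 5-cycle \<open>x p u v q\<close> through
  common neighbours \<open>p\<close> of \<open>x, u\<close> and \<open>q\<close> of \<open>x, v\<close>.
\<close>

text \<open>Turns the subgraph condition into one on adjacencies. The witness \<open>H\<close> keeps
  only the arcs with ends in \<open>S\<close>, which discards any chords of the cycle.\<close>

lemma (in graph) cycle_free_5D:
  assumes free: "cycle_free 5 G"
    and dist: "distinct [a, b, c, d, e]"
    and edges: "a \<rightarrow> b" "b \<rightarrow> c" "c \<rightarrow> d" "d \<rightarrow> e" "e \<rightarrow> a"
  shows False
proof -
  define S where "S = {(a, b), (b, a), (b, c), (c, b), (c, d), (d, c), (d, e), (e, d), (e, a), (a, e)}"
  define H where "H = G\<lparr>verts := {a, b, c, d, e}, arcs := {x \<in> arcs G. (tail G x, head G x) \<in> S}\<rparr>"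
  have S_edges: "S \<subseteq> arcs_ends G"
    using edges by (auto simp: S_def intro: graph_symmetric)
  have verts: "{a, b, c, d, e} \<subseteq> verts G"
    using edges adj_in_verts by auto
  have ends: "arcs_ends H = S"
    using S_edges by (auto simp: H_def arcs_ends_def arc_to_ends_def)
  have wf: "wf_digraph H"
    by unfold_locales (auto simp: H_def S_def)
  have sub: "subgraph H G"
    using verts wf by (auto simp: subgraph_def H_def compatible_def intro: wf_digraph_axioms)
  have "sym S"
    by (auto simp: S_def sym_def)
  interpret H: wf_digraph H
    by (rule wf)
  have graph: "graph H"
  proof unfold_locales
    show "finite (verts H)" "finite (arcs H)"
      by (auto simp: H_def)
    show "tail H x \<noteq> head H x" if "x \<in> arcs H" for x
      using that no_loops by (auto simp: H_def)
    show "x = y" if "x \<in> arcs H" "y \<in> arcs H" "arc_to_ends H x = arc_to_ends H y" for x y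
      using that no_multi_arcs by (auto simp: H_def arc_to_ends_def)
    show "symmetric H"
      unfolding symmetric_def ends by (rule \<open>sym S\<close>)
  qed
  have five: "{..<5::nat} = {0, 1, 2, 3, 4}"
    by auto
  define f where "f = (\<lambda>i. [a, b, c, d, e] ! i)"
  have "bij_betw f {..<5} (verts H)"
    unfolding bij_betw_def inj_on_def five using dist by (auto simp: f_def H_def)
  moreover have "arcs_ends H = (\<Union>i<5. {(f i, f (Suc i mod 5)), (f (Suc i mod 5), f i)})"
    unfolding ends five by (auto simp: f_def S_def)
  ultimately have "cycle_graph 5 H"
    unfolding cycle_graph_def using graph by auto
  with sub free show False
    unfolding cycle_free_def by blast
qed

text \<open>Three common neighbours cannot all lie in \<open>{p, q}\<close>.\<close>

lemma (in graph) common_neighbour_avoiding_two: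
  assumes "min_common_degree G \<ge> 3"
    and "x \<in> verts G" "y \<in> verts G" "x \<noteq> y" "\<not> x \<rightarrow> y"
  obtains w where "x \<rightarrow> w" "w \<rightarrow> y" "w \<noteq> p" "w \<noteq> q"
proof -
  let ?N = "nbhd G x \<inter> nbhd G y"
  have "(x, y) \<in> non_edges G"
    using assms by (simp add: non_edges_def)
  then have "min_common_degree G \<le> enat (card ?N)"
    unfolding min_common_degree_def by (rule INF_lower2) simp
  with assms(1) have "enat 3 \<le> enat (card ?N)"
    by (metis numeral_eq_enat order_trans)
  then have card: "3 \<le> card ?N"
    by simp
  have "\<not> ?N \<subseteq> {p, q}"
  proof
    assume "?N \<subseteq> {p, q}"
    then have "card ?N \<le> card {p, q}"
      by (intro card_mono) auto
    also have "\<dots> \<le> 2"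
      by (simp add: card_insert_if)
    finally show False
      using card by simp
  qed
  then show thesis
    using that by (auto simp: nbhd_def intro: graph_symmetric)
qed

locale C5_free_graph = graph +
  assumes C5_free: "cycle_free 5 G"
    and common_degree: "min_common_degree G \<ge> 3"
    and five_verts: "card (verts G) \<ge> 5"
begin

lemmas no_C5 = cycle_free_5D [OF C5_free]
lemmas common_neighbour = common_neighbour_avoiding_two [OF common_degree]

lemma edge_neq: "u \<rightarrow> v \<Longrightarrow> u \<noteq> v"
  using adj_not_same by blast

lemma other_vertex:
  assumes "card S \<le> 4" "finite S"
  obtains v where "v \<in> verts G" "v \<notin> S"
proof -
  have "\<not> verts G \<subseteq> S"
    using card_mono [OF \<open>finite S\<close>, of "verts G"] five_verts assms by auto
  then show thesis
    using that by blast
qed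

lemma no_K4_neighbour:
  assumes K4: "a \<rightarrow> b" "a \<rightarrow> c" "a \<rightarrow> d" "b \<rightarrow> c" "b \<rightarrow> d" "c \<rightarrow> d"
    and w: "w \<notin> {a, b, c, d}"
  shows "\<not> w \<rightarrow> a"
proof
  assume "w \<rightarrow> a"
  note edges = K4 K4 [THEN graph_symmetric] \<open>w \<rightarrow> a\<close>
  note neq = K4 [THEN edge_neq] K4 [THEN edge_neq, symmetric] w
  \<comment> \<open>A second neighbour of \<open>w\<close> in the K4 would close a 5-cycle with a
    path from \<open>a\<close> to it through all four vertices.\<close>
  have "\<not> w \<rightarrow> b"
    using no_C5 [of w a c d b] edges neq graph_symmetric by auto
  have "\<not> w \<rightarrow> d"
    using no_C5 [of w a b c d] edges neq graph_symmetric by auto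
  obtain u where u: "w \<rightarrow> u" "u \<rightarrow> b" "u \<noteq> a" "u \<noteq> c"
    using common_neighbour [of w b a c] \<open>\<not> w \<rightarrow> b\<close> edges neq adj_in_verts by auto
  have "u \<noteq> d"
    using u \<open>\<not> w \<rightarrow> d\<close> by auto
  then show False
    using no_C5 [of a w u b c] u(1,2) [THEN edge_neq] u edges neq graph_symmetric by auto
qed

lemma no_K4:
  assumes K4: "a \<rightarrow> b" "a \<rightarrow> c" "a \<rightarrow> d" "b \<rightarrow> c" "b \<rightarrow> d" "c \<rightarrow> d"
  shows False
proof -
  note edges = K4 K4 [THEN graph_symmetric]
  \<comment> \<open>\<open>card_length\<close> bounds the set by the length of the list, so
    distinctness need not be shown.\<close>
  obtain v where v: "v \<in> verts G" "v \<notin> {a, b, c, d}"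
    using other_vertex [of "{a, b, c, d}"] card_length [of "[a, b, c, d]"] by auto
  have isolated: "\<not> w \<rightarrow> a \<and> \<not> w \<rightarrow> b \<and> \<not> w \<rightarrow> c \<and> \<not> w \<rightarrow> d" if "w \<notin> {a, b, c, d}" for w
    using that edges no_K4_neighbour [of a b c d w] no_K4_neighbour [of b a c d w]
      no_K4_neighbour [of c a b d w] no_K4_neighbour [of d a b c w] by auto
  \<comment> \<open>If \<open>w\<close> lies in the K4, then \<open>v\<close> has a neighbour there;
    if not, \<open>w\<close> itself does. Both contradict \<open>isolated\<close>.\<close>
  then obtain w where "v \<rightarrow> w" "w \<rightarrow> a"
    using common_neighbour [of v a] v edges adj_in_verts by (metis insertI1)
  then show False
    using isolated [of w] isolated [OF v(2)] by auto
qed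

lemma no_diamond:
  assumes triangle: "a \<rightarrow> b" "b \<rightarrow> c" "c \<rightarrow> a" and d: "d \<rightarrow> a" "d \<rightarrow> b" "d \<noteq> c"
  shows False
proof -
  note edges = triangle d(1,2) triangle [THEN graph_symmetric] d(1,2) [THEN graph_symmetric]
  note neq = triangle [THEN edge_neq] d(1,2) [THEN edge_neq] d(3)
  have "\<not> d \<rightarrow> c"
    using no_K4 [of d a b c] edges by auto
  then obtain w where w: "d \<rightarrow> w" "w \<rightarrow> c" "w \<noteq> a" "w \<noteq> b"
    using common_neighbour [of d c a b] edges neq adj_in_verts by metis
  then show False
    using no_C5 [of d w c a b] w(1,2) [THEN edge_neq] edges neq by auto
qed

text \<open>The argument of \<open>no_K4_neighbour\<close> with \<open>no_diamond\<close> in place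
  of its first two 5-cycles.\<close>

lemma no_triangle_neighbour:
  assumes triangle: "a \<rightarrow> b" "b \<rightarrow> c" "c \<rightarrow> a" and w: "w \<notin> {a, b, c}"
  shows "\<not> w \<rightarrow> a"
proof
  assume "w \<rightarrow> a"
  note edges = triangle \<open>w \<rightarrow> a\<close> triangle [THEN graph_symmetric] \<open>w \<rightarrow> a\<close> [THEN graph_symmetric]
  note neq = triangle [THEN edge_neq] w
  have "\<not> w \<rightarrow> b" "\<not> w \<rightarrow> c"
    using no_diamond [of a b c w] no_diamond [of a c b w] edges neq by auto
  \<comment> \<open>Only \<open>a\<close> has to be avoided, so it fills both slots.\<close>
  obtain u where u: "w \<rightarrow> u" "u \<rightarrow> b" "u \<noteq> a"
    using common_neighbour [of w b a a] \<open>\<not> w \<rightarrow> b\<close> edges neq adj_in_verts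
    by (metis insertCI)
  have "u \<noteq> c"
    using u \<open>\<not> w \<rightarrow> c\<close> by auto
  then show False
    using no_C5 [of w u b c a] u u(1,2) [THEN edge_neq] edges neq by auto
qed

lemma no_triangle:
  assumes triangle: "a \<rightarrow> b" "b \<rightarrow> c" "c \<rightarrow> a"
  shows False
proof -
  note edges = triangle triangle [THEN graph_symmetric]
  obtain v where v: "v \<in> verts G" "v \<notin> {a, b, c}"
    using other_vertex [of "{a, b, c}"] card_length [of "[a, b, c]"] by auto
  have isolated: "\<not> w \<rightarrow> a \<and> \<not> w \<rightarrow> b \<and> \<not> w \<rightarrow> c" if "w \<notin> {a, b, c}" for w
    using that edges no_triangle_neighbour [of a b c w] no_triangle_neighbour [of b c a w]
      no_triangle_neighbour [of c a b w] by auto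
  then obtain w where "v \<rightarrow> w" "w \<rightarrow> a"
    using common_neighbour [of v a] v edges adj_in_verts by (metis insertI1)
  then show False
    using isolated [of w] isolated [OF v(2)] by auto
qed

lemma no_edge_outside_nbhd:
  assumes uv: "u \<rightarrow> v" and x: "x \<in> verts G" "\<not> x \<rightarrow> u" "\<not> x \<rightarrow> v"
  shows False
proof -
  \<comment> \<open>If \<open>x\<close> were an end of the edge, it would be adjacent to the other
    end.\<close>
  have neq: "u \<noteq> v" "x \<noteq> u" "x \<noteq> v"
    using uv x edge_neq graph_symmetric by auto
  obtain p where p: "x \<rightarrow> p" "p \<rightarrow> u"
    using common_neighbour [of x u] x uv neq adj_in_verts by metis
  obtain q where q: "x \<rightarrow> q" "q \<rightarrow> v"
    using common_neighbour [of x v] x uv neq adj_in_verts by metis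
  have "p \<noteq> q"
    using no_triangle [of p u v] p q uv graph_symmetric by auto
  \<comment> \<open>\<open>p\<close> and \<open>q\<close> differ from \<open>u\<close> and
    \<open>v\<close> because they are neighbours of \<open>x\<close>.\<close>
  then show False
    using no_C5 [of x p u v q] p q uv x neq edge_neq graph_symmetric by auto
qed

lemma bipartite: "bipartite G"
proof -
  obtain x where x: "x \<in> verts G"
    using other_vertex [of "{}"] by auto
  let ?A = "nbhd G x" and ?B = "verts G - nbhd G x"
  \<comment> \<open>An edge inside \<open>?A\<close> would form a triangle with
    \<open>x\<close>.\<close>
  have "(u, v) \<in> ?A \<times> ?B \<union> ?B \<times> ?A" if "u \<rightarrow> v" for u v
    using no_triangle [of x u v] no_edge_outside_nbhd [of u v x] x that adj_in_verts [OF that]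
    by (auto simp: nbhd_def intro: graph_symmetric)
  then have "arcs_ends G \<subseteq> ?A \<times> ?B \<union> ?B \<times> ?A"
    by auto
  moreover have "verts G = ?A \<union> ?B" "?A \<inter> ?B = {}"
    by (auto simp: nbhd_def)
  ultimately show ?thesis
    unfolding bipartite_def by blast
qed

end

theorem theorem1p6:
  fixes G :: "('a, 'b) pre_digraph" and n :: nat
  assumes "graph G"
    and "card (verts G) = n"
    and "n \<ge> 5"
    and "cycle_free 5 G"
    and "min_common_degree G \<ge> 3"
  shows "bipartite G"
proof -
  interpret C5_free_graph G
    using assms by (simp add: C5_free_graph_def C5_free_graph_axioms_def)
  show ?thesis
    by (rule bipartite)
qed

end
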